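(* Let $\mathbf{C}\subset\mathbb{R}^N$ be a closed convex set (with nonempty interior) of class $C^1$. Then $\mathbf{C}$ satisfies the $0$-ABP property; that is, for every finite nonempty subset $K\subset\partial\mathbf{C}$ and every function $v:K\to\mathbb{R}$, $$|\mathcal{B}^0_v\cap B_1|\ \ge\ |B^0|.$$
   Context: $B_1$ is the open unit ball of $\mathbb{R}^N$ centered at the origin, $B^0=\{x\in B_1: x\cdot e_N>0\}$, and $|\cdot|$ is Lebesgue measure. $\nu_{\mathbf{C}}(x)$ is the outer unit normal to $\mathbf{C}$ at $x\in\partial\mathbf{C}$. For $K\subset\partial\mathbf{C}$, $v:K\to\mathbb{R}$, $x\in K$: $$J_Kv(x)=\{\xi\in\mathbb{R}^N:\ v(y)-v(x)\ge\xi\cdot(y-x)\ \text{ for all }y\in K\},\qquad \mathcal{B}^0_v=\bigcup_{x\in K}\{\xi\in J_Kv(x):\ \xi\cdot\nu_{\mathbf{C}}(x)>0\}.$$ *)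

theory Defs
  imports "HOL-Analysis.Analysis"
begin

definition hyp_proj :: "'a::euclidean_space \<Rightarrow> 'a \<Rightarrow> 'a" where
  "hyp_proj e y = y - (y \<bullet> e) *\<^sub>R e"

text \<open>
  Near \<open>x\<close>, and in orthonormal coordinates whose last axis is the unit vector \<open>e\<close>, the set \<open>C\<close>
  is the region below the graph of a function \<open>\<psi>\<close> of class \<open>C\<^sup>1\<close> on the hyperplane orthogonal to
  \<open>e\<close>, which plays the role of \<open>\<real>\<^bsup>N-1\<^esup>\<close>. The vector \<open>g z\<close> is the gradient of \<open>\<psi>\<close> at \<open>z\<close>
  relative to that hyperplane; it is unique because it is required to be orthogonal to \<open>e\<close>.
  Values of \<open>\<psi>\<close> and \<open>g\<close> off the hyperplane are irrelevant.
\<close>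

definition C1_graph_at ::
    "'a::euclidean_space set \<Rightarrow> 'a \<Rightarrow> 'a \<Rightarrow> ('a \<Rightarrow> real) \<Rightarrow> ('a \<Rightarrow> 'a) \<Rightarrow> bool" where
  "C1_graph_at C x e \<psi> g \<longleftrightarrow>
     norm e = 1 \<and>
     (\<forall>z. z \<bullet> e = 0 \<longrightarrow>
        g z \<bullet> e = 0 \<and>
        (\<psi> has_derivative (\<lambda>h. g z \<bullet> h)) (at z within {y. y \<bullet> e = 0})) \<and>
     continuous_on {z. z \<bullet> e = 0} g \<and>
     (\<exists>r>0. C \<inter> ball x r = {y \<in> ball x r. y \<bullet> e \<le> \<psi> (hyp_proj e y)})"

definition class_C1 :: "'a::euclidean_space set \<Rightarrow> bool" where
  "class_C1 C \<longleftrightarrow> (\<forall>x \<in> frontier C. \<exists>e \<psi> g. C1_graph_at C x e \<psi> g)"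

text \<open>
  In the coordinates above the outer unit normal is
  \<open>(-\<nabla>\<psi>, 1) / sqrt (1 + |\<nabla>\<psi>|\<^sup>2)\<close>, and \<open>sgn w\<close> is \<open>w\<close> divided by its norm.
  It does not depend on the graph representation: see \<open>outer_unit_normal_eq\<close> below.
\<close>

definition outer_unit_normal :: "'a::euclidean_space set \<Rightarrow> 'a \<Rightarrow> 'a" where
  "outer_unit_normal C x =
     (THE \<nu>. \<exists>e \<psi> g. C1_graph_at C x e \<psi> g \<and> \<nu> = sgn (e - g (hyp_proj e x)))"

definition subdiff :: "'a::euclidean_space set \<Rightarrow> ('a \<Rightarrow> real) \<Rightarrow> 'a \<Rightarrow> 'a set" where
  "subdiff K v x = {\<xi>. \<forall>y\<in>K. v y - v x \<ge> \<xi> \<bullet> (y - x)}"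

definition outward_subgradients ::
    "'a::euclidean_space set \<Rightarrow> 'a set \<Rightarrow> ('a \<Rightarrow> real) \<Rightarrow> 'a set" where
  "outward_subgradients C K v =
     (\<Union>x\<in>K. {\<xi> \<in> subdiff K v x. \<xi> \<bullet> outer_unit_normal C x > 0})"

definition half_ball :: "'a::euclidean_space \<Rightarrow> 'a set" where
  "half_ball e = {x \<in> ball 0 1. x \<bullet> e > 0}"

text \<open>
  The \<open>0\<close>-ABP property, with \<open>e\<close> in the role of the last vector of the standard basis. A function
  on \<open>K\<close> is represented by a total function, of which only the values on \<open>K\<close> enter.
\<close>

definition zero_ABP :: "'a::euclidean_space \<Rightarrow> 'a set \<Rightarrow> bool" where
  "zero_ABP e C \<longleftrightarrow>
     (\<forall>K v. finite K \<and> K \<noteq> {} \<and> K \<subseteq> frontier C \<longrightarrow>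
        emeasure lebesgue (outward_subgradients C K v \<inter> ball 0 1)
          \<ge> emeasure lebesgue (half_ball e))"

lemma hyp_proj_orth: "norm e = 1 \<Longrightarrow> hyp_proj e y \<bullet> e = 0"
  by (simp add: hyp_proj_def inner_diff_left norm_eq_1)

lemma C1_graph_at_has_derivative:
  assumes "C1_graph_at C x e \<psi> g"
  shows "((\<lambda>y. y \<bullet> e - \<psi> (hyp_proj e y)) has_derivative
          (\<lambda>h. (e - g (hyp_proj e x)) \<bullet> h)) (at x)"
proof -
  have e: "norm e = 1" and ge: "g (hyp_proj e x) \<bullet> e = 0"
    and d: "(\<psi> has_derivative (\<lambda>h. g (hyp_proj e x) \<bullet> h)) (at (hyp_proj e x) within {y. y \<bullet> e = 0})"
    using assms hyp_proj_orth by (auto simp: C1_graph_at_def)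
  have p: "(hyp_proj e has_derivative hyp_proj e) (at x)"
    unfolding hyp_proj_def by (auto intro!: derivative_eq_intros)
  have "((\<lambda>y. \<psi> (hyp_proj e y)) has_derivative (\<lambda>h. g (hyp_proj e x) \<bullet> hyp_proj e h)) (at x)"
    by (rule has_derivative_in_compose2[OF _ _ _ p, where t = "{y. y \<bullet> e = 0}" and
          g' = "\<lambda>z h. g z \<bullet> h"])
       (use e assms hyp_proj_orth in \<open>auto simp: C1_graph_at_def\<close>)
  moreover have "g (hyp_proj e x) \<bullet> hyp_proj e h = g (hyp_proj e x) \<bullet> h" for h
    using ge by (simp add: hyp_proj_def inner_diff_right)
  ultimately show ?thesis
    by (auto intro!: derivative_eq_intros simp: inner_diff_right inner_commute)
qed

lemma C1_graph_at_frontier: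
  assumes G: "C1_graph_at C x e \<psi> g" and x: "x \<in> frontier C"
  shows "x \<bullet> e = \<psi> (hyp_proj e x)"
proof -
  let ?f = "\<lambda>y. y \<bullet> e - \<psi> (hyp_proj e y)"
  obtain r where r: "r > 0" "C \<inter> ball x r = {y \<in> ball x r. y \<bullet> e \<le> \<psi> (hyp_proj e y)}"
    using G unfolding C1_graph_at_def by blast
  have mem: "y \<in> C \<longleftrightarrow> ?f y \<le> 0" if "y \<in> ball x r" for y
  proof -
    have "y \<in> C \<longleftrightarrow> y \<in> C \<inter> ball x r" using that by blast
    also have "\<dots> \<longleftrightarrow> ?f y \<le> 0" unfolding r(2) using that by simp
    finally show ?thesis .
  qed
  have c: "(?f \<longlongrightarrow> ?f x) (nhds x)"
    using has_derivative_continuous[OF C1_graph_at_has_derivative[OF G]]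
    unfolding isCont_def by (subst (asm) tendsto_at_iff_tendsto_nhds) simp
  have b: "eventually (\<lambda>y. y \<in> ball x r) (nhds x)"
    using r(1) by (intro eventually_nhds_in_open) auto
  have 1: "\<not> ?f x < 0"
  proof
    assume "?f x < 0"
    then have "eventually (\<lambda>y. ?f y < 0) (nhds x)" using order_tendstoD[OF c] by blast
    then have "eventually (\<lambda>y. y \<in> C) (nhds x)" using b by eventually_elim (auto simp: mem)
    then have "x \<in> interior C" by (auto simp: eventually_nhds interior_def)
    with x show False by (simp add: frontier_def)
  qed
  have 2: "\<not> ?f x > 0"
  proof
    assume "?f x > 0"
    then have "eventually (\<lambda>y. ?f y > 0) (nhds x)" using order_tendstoD[OF c] by blast
    then have "eventually (\<lambda>y. y \<in> - C) (nhds x)" using b by eventually_elim (auto simp: mem)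
    then have "x \<in> interior (- C)" by (auto simp: eventually_nhds interior_def)
    with x show False by (simp add: frontier_def interior_complement)
  qed
  from 1 2 show ?thesis by simp
qed

lemma C1_graph_at_ray:
  assumes G: "C1_graph_at C x e \<psi> g" and x: "x \<in> frontier C"
  shows "(e - g (hyp_proj e x)) \<bullet> h < 0 \<Longrightarrow>
           eventually (\<lambda>t. x + t *\<^sub>R h \<in> C) (at_right (0::real))"
    and "(e - g (hyp_proj e x)) \<bullet> h > 0 \<Longrightarrow>
           eventually (\<lambda>t. x + t *\<^sub>R h \<notin> C) (at_right (0::real))"
proof -
  let ?f = "\<lambda>y. y \<bullet> e - \<psi> (hyp_proj e y)"
  let ?n = "e - g (hyp_proj e x)"
  obtain r where r: "r > 0" "C \<inter> ball x r = {y \<in> ball x r. y \<bullet> e \<le> \<psi> (hyp_proj e y)}"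
    using G unfolding C1_graph_at_def by blast
  have mem: "y \<in> C \<longleftrightarrow> ?f y \<le> 0" if "y \<in> ball x r" for y
  proof -
    have "y \<in> C \<longleftrightarrow> y \<in> C \<inter> ball x r" using that by blast
    also have "\<dots> \<longleftrightarrow> ?f y \<le> 0" unfolding r(2) using that by simp
    finally show ?thesis .
  qed
  have "((\<lambda>t. x + t *\<^sub>R h) \<longlongrightarrow> x + 0 *\<^sub>R h) (at_right 0)" by (intro tendsto_intros)
  then have b: "eventually (\<lambda>t. x + t *\<^sub>R h \<in> ball x r) (at_right 0)"
    using r(1) by (auto dest!: topological_tendstoD[where S = "ball x r"])
  have l: "((\<lambda>t::real. x + t *\<^sub>R h) has_derivative (\<lambda>t. t *\<^sub>R h)) (at 0)"
    by (auto intro!: derivative_eq_intros)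
  have "((\<lambda>t. ?f (x + t *\<^sub>R h)) has_derivative (\<lambda>t. ?n \<bullet> (t *\<^sub>R h))) (at 0)"
    using has_derivative_compose[OF l, of ?f "\<lambda>h. ?n \<bullet> h"] C1_graph_at_has_derivative[OF G]
    by simp
  then have "((\<lambda>t. ?f (x + t *\<^sub>R h)) has_real_derivative (?n \<bullet> h)) (at 0)"
    by (rule has_derivative_imp_has_field_derivative) (simp add: mult.commute)
  then have "((\<lambda>t. (?f (x + t *\<^sub>R h) - ?f (x + 0 *\<^sub>R h)) / t) \<longlongrightarrow> ?n \<bullet> h) (at 0)"
    by (simp add: DERIV_def)
  then have q: "((\<lambda>t. ?f (x + t *\<^sub>R h) / t) \<longlongrightarrow> ?n \<bullet> h) (at_right 0)"
    using C1_graph_at_frontier[OF G x] by (simp add: filterlim_at_split)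
  have pos: "eventually (\<lambda>t. t > 0) (at_right (0::real))" by (simp add: eventually_at_right_less)
  { assume "?n \<bullet> h < 0"
    with q have "eventually (\<lambda>t. ?f (x + t *\<^sub>R h) / t < 0) (at_right 0)" by (rule order_tendstoD)
    then show "eventually (\<lambda>t. x + t *\<^sub>R h \<in> C) (at_right 0)"
      using b pos
    proof eventually_elim
      case (elim t)
      then have "?f (x + t *\<^sub>R h) < 0" by (simp only: divide_less_0_iff) auto
      then show ?case using mem[OF elim(2)] by linarith
    qed }
  { assume "?n \<bullet> h > 0"
    with q have "eventually (\<lambda>t. ?f (x + t *\<^sub>R h) / t > 0) (at_right 0)" by (rule order_tendstoD)
    then show "eventually (\<lambda>t. x + t *\<^sub>R h \<notin> C) (at_right 0)"
      using b pos
    proof eventually_elim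
      case (elim t)
      then have "?f (x + t *\<^sub>R h) > 0" by (simp only: zero_less_divide_iff) auto
      then show ?case using mem[OF elim(2)] by linarith
    qed }
qed

lemma C1_graph_at_normal_nonzero:
  assumes "C1_graph_at C x e \<psi> g"
  shows "e - g (hyp_proj e x) \<noteq> 0"
proof
  have e: "norm e = 1" and ge: "g (hyp_proj e x) \<bullet> e = 0"
    using assms hyp_proj_orth by (auto simp: C1_graph_at_def)
  assume "e - g (hyp_proj e x) = 0"
  then have "e \<bullet> e = 0" using ge by simp
  with e show False by simp
qed

lemma C1_graph_at_normal_unique:
  assumes G: "C1_graph_at C x e \<psi> g" and G': "C1_graph_at C x e' \<psi>' g'"
    and x: "x \<in> frontier C"
  shows "sgn (e - g (hyp_proj e x)) = sgn (e' - g' (hyp_proj e' x))"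
proof (rule ccontr)
  define n where "n = e - g (hyp_proj e x)"
  define n' where "n' = e' - g' (hyp_proj e' x)"
  assume "\<not> ?thesis"
  then have ne: "sgn n \<noteq> sgn n'" by (simp add: n_def n'_def)
  have nz: "n \<noteq> 0" "n' \<noteq> 0"
    using C1_graph_at_normal_nonzero[OF G] C1_graph_at_normal_nonzero[OF G']
    by (auto simp: n_def n'_def)
  have u: "norm (sgn n) = 1" "norm (sgn n') = 1" using nz by (simp_all add: norm_sgn)
  define h where "h = sgn n' - sgn n"
  have "0 < (norm h)\<^sup>2" using ne by (simp add: h_def)
  also have "(norm h)\<^sup>2 = 2 - 2 * (sgn n \<bullet> sgn n')"
    using u by (simp add: h_def power2_norm_eq_inner inner_diff inner_commute norm_eq_1)
  finally have c: "sgn n \<bullet> sgn n' < 1" by simp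
  have "sgn n \<bullet> h < 0" "sgn n' \<bullet> h > 0"
    using c u by (auto simp: h_def inner_diff_right inner_commute norm_eq_1)
  then have "n \<bullet> h < 0" "n' \<bullet> h > 0"
    using nz by (auto simp: sgn_div_norm mult_less_0_iff zero_less_mult_iff divide_less_0_iff zero_less_divide_iff)
  then have "eventually (\<lambda>t. x + t *\<^sub>R h \<in> C) (at_right (0::real))"
    "eventually (\<lambda>t. x + t *\<^sub>R h \<notin> C) (at_right (0::real))"
    using C1_graph_at_ray(1)[OF G x] C1_graph_at_ray(2)[OF G' x] by (auto simp: n_def n'_def)
  then have "eventually (\<lambda>t. False) (at_right (0::real))" by eventually_elim simp
  then show False by simp
qed

lemma outer_unit_normal_eq:
  assumes "C1_graph_at C x e \<psi> g" and "x \<in> frontier C"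
  shows "outer_unit_normal C x = sgn (e - g (hyp_proj e x))"
  unfolding outer_unit_normal_def
  using assms C1_graph_at_normal_unique[OF _ assms] by (intro the_equality) blast+

end

theory Submission imports Defs begin

text \<open>
  Every \<open>\<xi>\<close> lies in some \<open>subdiff K v x\<close>, because the finite set \<open>K\<close> contains a minimum point
  \<open>x\<close> of \<open>y \<mapsto> v y - \<xi> \<bullet> y\<close> (\<open>subdiff_covers\<close>). For two different points these sets meet only in
  a hyperplane (\<open>negligible_subdiff_Int\<close>), so they cut the unit ball into finitely many pieces
  without overlap of positive measure. It is therefore enough that at least half of each piece
  points outward, that is, satisfies \<open>\<xi> \<bullet> n > 0\<close> for the outer unit normal \<open>n\<close> at \<open>x\<close>.

  Convexity enters here: \<open>C\<close>, and hence \<open>K\<close>, lies in the half-space \<open>n \<bullet> (y - x) \<le> 0\<close>. Adding a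
  nonnegative multiple of \<open>n\<close> to \<open>\<xi>\<close> only decreases \<open>\<xi> \<bullet> (y - x)\<close>, so \<open>subdiff K v x\<close> is stable
  under such translations. The reflection in the hyperplane orthogonal to \<open>n\<close> moves a vector with
  \<open>\<xi> \<bullet> n < 0\<close> by the positive multiple \<open>- 2 (\<xi> \<bullet> n)\<close> of \<open>n\<close> and preserves its norm. It thus maps
  the inward part of each piece into the outward part, and it preserves measure
  (\<open>measure_subdiff_inward_le_outward\<close>). Summing over \<open>K\<close> gives at least half the measure of the ball,
  which is the measure of a half ball.
\<close>

section \<open>Invariance of Lebesgue measure under orthogonal transformations\<close>

text \<open>
  By Vitali's covering theorem, an open set is a disjoint union of balls up to a null set. An
  orthogonal transformation maps a ball to a ball of the same radius, and keeps disjoint sets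
  disjoint and null sets null.
\<close>

lemma emeasure_lborel_orthogonal_image_open:
  fixes f :: "'a::euclidean_space \<Rightarrow> 'a"
  assumes f: "orthogonal_transformation f" and U: "open U"
  shows "emeasure lborel (f ` U) = emeasure lborel U"
proof -
  define K where "K = {i :: 'a \<times> real. ball (fst i) (snd i) \<subseteq> U}"
  have fine: "\<exists>i. i \<in> K \<and> x \<in> ball (fst i) (snd i) \<and> snd i < d" if "x \<in> U" "0 < d" for x d
  proof -
    obtain e where "e > 0" "ball x e \<subseteq> U"
      using U \<open>x \<in> U\<close> openE by blast
    then have "ball x (min e (d/2)) \<subseteq> U"
      by (meson subset_ball min.cobounded1 subset_trans)
    then have "(x, min e (d/2)) \<in> K"
      by (simp add: K_def)
    moreover have "x \<in> ball x (min e (d/2))" and "min e (d/2) < d"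
      using \<open>0 < d\<close> \<open>0 < e\<close> by auto
    ultimately show ?thesis
      by (metis fst_conv snd_conv)
  qed
  obtain D where D: "countable D" "D \<subseteq> K"
      and disj: "pairwise (\<lambda>i j. disjnt (ball (fst i) (snd i)) (ball (fst j) (snd j))) D"
      and neg: "negligible (U - (\<Union>i\<in>D. ball (fst i) (snd i)))"
    by (rule Vitali_covering_theorem_balls[of U K fst snd, OF fine])
  let ?V = "\<Union>i\<in>D. ball (fst i) (snd i)"
  let ?W = "\<Union>i\<in>D. ball (f (fst i)) (snd i)"
  have fball: "f ` ball x r = ball (f x) r" for x r
    by (rule image_orthogonal_transformation_ball[OF f])
  have VU: "?V \<subseteq> U" and fV: "f ` ?V = ?W"
    using D(2) by (auto simp: K_def fball image_UN)
  have inj: "inj f"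
    by (rule orthogonal_transformation_inj[OF f])
  have opens: "open (f ` U)" "open ?V" "open ?W"
    using U open_surjective_linear_image[OF U orthogonal_transformation_linear orthogonal_transformation_surj] f
    by auto
  have "disjoint_family_on (\<lambda>i. ball (fst i) (snd i)) D"
    using disj by (auto simp: disjoint_family_on_def pairwise_def disjnt_def)
  moreover have "disjoint_family_on (\<lambda>i. ball (f (fst i)) (snd i)) D"
    using disj inj by (auto simp: disjoint_family_on_def pairwise_def disjnt_def
        simp flip: fball image_Int)
  moreover have "emeasure lborel (ball (fst i) (snd i)) = emeasure lborel (ball (f (fst i)) (snd i))" for i
    by (cases "snd i \<ge> 0") (simp_all add: emeasure_ball ball_empty)
  ultimately have VW: "emeasure lborel ?V = emeasure lborel ?W"
    using D(1) by (simp add: emeasure_UN_countable)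
  have ae: "emeasure lborel A = emeasure lborel B"
    if "open A" "open B" "B \<subseteq> A" "negligible (A - B)" for A B :: "'a set"
  proof (rule emeasure_eq_AE)
    have "A - B \<in> null_sets lborel"
      using that by (simp add: negligible_iff_null_sets null_sets_completion_iff borel_open sets.Diff)
    then show "AE x in lborel. x \<in> A \<longleftrightarrow> x \<in> B"
      using \<open>B \<subseteq> A\<close> by (auto elim!: AE_I')
  qed (use that in auto)
  have "f ` U - ?W = f ` (U - ?V)"
    using inj by (simp add: image_set_diff flip: fV)
  then have "negligible (f ` U - ?W)"
    using negligible_differentiable_image_negligible[OF order_refl neg
        linear_imp_differentiable_on[OF orthogonal_transformation_linear[OF f]]]
    by simp
  then have "emeasure lborel (f ` U) = emeasure lborel ?W"
    using image_mono[OF VU, of f] unfolding fV by (intro ae opens)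
  also have "\<dots> = emeasure lborel U"
    using ae[OF U opens(2) VU neg] VW by simp
  finally show ?thesis .
qed

lemma borel_measurable_orthogonal_transformation:
  fixes f :: "'a::euclidean_space \<Rightarrow> 'a"
  assumes "orthogonal_transformation f"
  shows "f \<in> borel_measurable borel"
  using orthogonal_transformation_linear[OF assms]
  by (simp add: borel_measurable_continuous_onI linear_continuous_on linear_conv_bounded_linear)

lemma lborel_distr_orthogonal_transformation:
  fixes f :: "'a::euclidean_space \<Rightarrow> 'a"
  assumes f: "orthogonal_transformation f"
  shows "distr lborel borel f = lborel"
proof (rule lborel_eqI[symmetric])
  fix l u :: 'a
  assume lu: "\<And>b. b \<in> Basis \<Longrightarrow> l \<bullet> b \<le> u \<bullet> b"
  have meas: "f \<in> borel_measurable lborel"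
    using borel_measurable_orthogonal_transformation[OF f] by simp
  have "f -` box l u = inv f ` box l u"
    using orthogonal_transformation_bij[OF f] by (simp add: bij_vimage_eq_inv_image)
  then have "emeasure (distr lborel borel f) (box l u) = emeasure lborel (inv f ` box l u)"
    using meas by (simp add: emeasure_distr)
  also have "\<dots> = emeasure lborel (box l u)"
    by (intro emeasure_lborel_orthogonal_image_open orthogonal_transformation_inv f open_box)
  also have "\<dots> = (\<Prod>b\<in>Basis. (u - l) \<bullet> b)"
    using lu by (simp add: emeasure_lborel_box)
  finally show "emeasure (distr lborel borel f) (box l u) = (\<Prod>b\<in>Basis. (u - l) \<bullet> b)" .
qed simp

lemma measure_orthogonal_vimage:
  fixes f :: "'a::euclidean_space \<Rightarrow> 'a"
  assumes f: "orthogonal_transformation f" and S: "S \<in> sets borel"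
  shows "measure lebesgue (f -` S) = measure lebesgue S"
proof -
  have meas: "f \<in> borel_measurable borel"
    by (rule borel_measurable_orthogonal_transformation[OF f])
  then have "measure lborel S = measure lborel (f -` S)"
    using S measure_distr[of f lborel borel S]
    by (simp add: lborel_distr_orthogonal_transformation[OF f])
  then show ?thesis
    using S measurable_sets[OF meas S] by simp
qed

section \<open>Subgradients and supporting normals\<close>

text \<open>For a unit vector \<open>n\<close>, this is the reflection in the hyperplane orthogonal to \<open>n\<close>.\<close>

definition reflect_in :: "'a::real_inner \<Rightarrow> 'a \<Rightarrow> 'a" where
  "reflect_in n \<xi> = \<xi> - (2 * (\<xi> \<bullet> n)) *\<^sub>R n"

lemma orthogonal_transformation_reflect_in:
  fixes n :: "'a::euclidean_space"
  assumes "norm n = 1"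
  shows "orthogonal_transformation (reflect_in n)"
proof -
  have nn: "n \<bullet> n = 1"
    using assms norm_eq_1 by blast
  have "linear (reflect_in n)"
    by (rule linearI)
       (simp_all add: reflect_in_def inner_add_left scaleR_add_left distrib_left scaleR_diff_right
         mult.left_commute)
  moreover have "reflect_in n v \<bullet> reflect_in n w = v \<bullet> w" for v w
    by (simp add: reflect_in_def inner_diff_left inner_diff_right nn inner_commute[of n w])
  ultimately show ?thesis
    by (simp add: orthogonal_transformation_def)
qed

text \<open>The subdifferential at \<open>x\<close> absorbs the normal cone of \<open>K\<close> at \<open>x\<close>.\<close>

lemma subdiff_add_normal:
  assumes "\<xi> \<in> subdiff K v x" and "0 \<le> t" and "\<And>y. y \<in> K \<Longrightarrow> n \<bullet> (y - x) \<le> 0"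
  shows "\<xi> + t *\<^sub>R n \<in> subdiff K v x"
proof -
  have "(\<xi> + t *\<^sub>R n) \<bullet> (y - x) \<le> v y - v x" if "y \<in> K" for y
    using assms that mult_nonneg_nonpos[of t "n \<bullet> (y - x)"]
    by (auto simp: subdiff_def inner_add_left intro: add_decreasing2)
  then show ?thesis
    by (simp add: subdiff_def)
qed

lemma closed_subdiff: "closed (subdiff K v x)"
proof -
  have "subdiff K v x = (\<Inter>y\<in>K. {\<xi>. (y - x) \<bullet> \<xi> \<le> v y - v x})"
    by (auto simp: subdiff_def inner_commute)
  then show ?thesis
    by (auto intro!: closed_INT closed_halfspace_le)
qed

text \<open>
  The defining inequality of \<open>subdiff K v x\<close> says that \<open>x\<close> minimises \<open>y \<mapsto> v y - \<xi> \<bullet> y\<close> over \<open>K\<close>.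
\<close>

lemma subdiff_covers:
  assumes "finite K" and "K \<noteq> {}"
  shows "\<exists>x\<in>K. \<xi> \<in> subdiff K v x"
proof -
  obtain x where "x \<in> K" and min: "\<And>y. y \<in> K \<Longrightarrow> v x - \<xi> \<bullet> x \<le> v y - \<xi> \<bullet> y"
    using ex_min_if_finite[of "(\<lambda>y. v y - \<xi> \<bullet> y) ` K"] assms by fastforce
  then show ?thesis
    by (intro bexI[of _ x]) (force simp: subdiff_def inner_diff_right)+
qed

lemma borel_subdiff_parts:
  fixes n :: "'a::euclidean_space"
  shows "subdiff K v x \<inter> ball 0 1 \<inter> {\<xi>. \<xi> \<bullet> n > 0} \<in> sets borel"
    and "subdiff K v x \<inter> ball 0 1 \<inter> {\<xi>. \<xi> \<bullet> n < 0} \<in> sets borel"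
proof -
  have "subdiff K v x \<inter> ball 0 1 \<in> sets borel"
    using borel_closed[OF closed_subdiff[of K v x]] by simp
  moreover have "{\<xi>. \<xi> \<bullet> n < 0} \<in> sets borel" "{\<xi>. \<xi> \<bullet> n > 0} \<in> sets borel"
    using open_halfspace_lt[of n 0] open_halfspace_gt[of 0 n] by (simp_all add: inner_commute borel_open)
  ultimately show "subdiff K v x \<inter> ball 0 1 \<inter> {\<xi>. \<xi> \<bullet> n > 0} \<in> sets borel"
    and "subdiff K v x \<inter> ball 0 1 \<inter> {\<xi>. \<xi> \<bullet> n < 0} \<in> sets borel"
    by blast+
qed

text \<open>
  If both \<open>x\<close> and \<open>y\<close> are minimum points of the same function, its values there agree, which is
  a nontrivial linear equation for \<open>\<xi>\<close>.
\<close>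

lemma negligible_subdiff_Int:
  assumes "x \<in> K" "y \<in> K" "x \<noteq> y"
  shows "negligible (subdiff K v x \<inter> subdiff K v y)"
proof (rule negligible_subset)
  show "negligible {\<xi>. (y - x) \<bullet> \<xi> = v y - v x}"
    using assms by (intro negligible_hyperplane) auto
  show "subdiff K v x \<inter> subdiff K v y \<subseteq> {\<xi>. (y - x) \<bullet> \<xi> = v y - v x}"
    using assms by (force simp: subdiff_def inner_diff_right inner_diff_left inner_commute)
qed

text \<open>
  Reflecting an inward subgradient adds a nonnegative multiple of the normal to it; the result is
  an outward subgradient of the same norm.
\<close>

lemma measure_subdiff_inward_le_outward:
  fixes x n :: "'a::euclidean_space"
  assumes n: "norm n = 1" and supp: "\<And>y. y \<in> K \<Longrightarrow> n \<bullet> (y - x) \<le> 0"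
  shows "measure lebesgue (subdiff K v x \<inter> ball 0 1 \<inter> {\<xi>. \<xi> \<bullet> n < 0})
       \<le> measure lebesgue (subdiff K v x \<inter> ball 0 1 \<inter> {\<xi>. \<xi> \<bullet> n > 0})"
proof -
  let ?J = "subdiff K v x \<inter> ball 0 1"
  let ?A = "?J \<inter> {\<xi>. \<xi> \<bullet> n > 0}" and ?D = "?J \<inter> {\<xi>. \<xi> \<bullet> n < 0}"
  have orth: "orthogonal_transformation (reflect_in n)"
    using n by (rule orthogonal_transformation_reflect_in)
  have A: "?A \<in> sets borel" and D: "?D \<in> sets borel"
    by (rule borel_subdiff_parts)+
  have refA: "reflect_in n -` ?A \<in> sets borel"
    by (rule measurable_sets_borel[OF borel_measurable_orthogonal_transformation[OF orth] A])
  have "?D \<subseteq> reflect_in n -` ?A"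
  proof
    fix \<xi> assume \<xi>: "\<xi> \<in> ?D"
    then have "reflect_in n \<xi> \<in> subdiff K v x"
      using subdiff_add_normal[of \<xi> K v x "- 2 * (\<xi> \<bullet> n)" n] supp by (auto simp: reflect_in_def)
    moreover have "reflect_in n \<xi> \<bullet> n = - (\<xi> \<bullet> n)"
      using n by (simp add: reflect_in_def inner_diff_left norm_eq_1)
    ultimately show "\<xi> \<in> reflect_in n -` ?A"
      using \<xi> orthogonal_transformation_norm[OF orth, of \<xi>] by auto
  qed
  moreover have "reflect_in n -` ?A \<in> lmeasurable"
  proof (rule bounded_set_imp_lmeasurable)
    have "reflect_in n -` ?A \<subseteq> ball 0 1"
      using orthogonal_transformation_norm[OF orth] by auto
    then show "bounded (reflect_in n -` ?A)"
      by (rule bounded_subset[OF bounded_ball])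
  qed (use refA in auto)
  ultimately have "measure lebesgue ?D \<le> measure lebesgue (reflect_in n -` ?A)"
    using D by (intro measure_mono_fmeasurable) auto
  also have "\<dots> = measure lebesgue ?A"
    by (rule measure_orthogonal_vimage[OF orth A])
  finally show ?thesis .
qed

text \<open>
  The vector \<open>n x\<close> is any unit vector in the normal cone of \<open>K\<close> at \<open>x\<close>. The union bound suffices for the inward parts; for the outward parts \<open>A x\<close> the measure of the union has to
  equal the sum, and this is where the negligible overlaps are used.
\<close>

lemma measure_outward_subgradients_ge:
  fixes n :: "'a::euclidean_space \<Rightarrow> 'a"
    and v :: "'a \<Rightarrow> real"
  assumes K: "finite K" "K \<noteq> {}"
    and n: "\<And>x. x \<in> K \<Longrightarrow> norm (n x) = 1"
    and supp: "\<And>x y. x \<in> K \<Longrightarrow> y \<in> K \<Longrightarrow> n x \<bullet> (y - x) \<le> 0"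
  defines "A \<equiv> (\<lambda>x. subdiff K v x \<inter> ball 0 1 \<inter> {\<xi>. \<xi> \<bullet> n x > 0})"
  shows "(\<Union>x\<in>K. A x) \<in> lmeasurable"
    and "measure lebesgue (ball 0 1 :: 'a set) \<le> 2 * measure lebesgue (\<Union>x\<in>K. A x)"
proof -
  define D where "D = (\<lambda>x. subdiff K v x \<inter> ball 0 1 \<inter> {\<xi>. \<xi> \<bullet> n x < 0})"
  define Z where "Z = (\<Union>x\<in>K. {\<xi>. n x \<bullet> \<xi> = 0})"
  have bd: "bounded (subdiff K v x \<inter> ball 0 1 \<inter> H)" for x H
    by (meson bounded_Int bounded_ball)
  have A: "A x \<in> lmeasurable" and D: "D x \<in> lmeasurable" for x
    unfolding A_def D_def using borel_subdiff_parts[of K v x "n x"]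
    by (auto intro!: bounded_set_imp_lmeasurable bd)
  then show UA: "(\<Union>x\<in>K. A x) \<in> lmeasurable"
    using K by auto
  have UD: "(\<Union>x\<in>K. D x) \<in> lmeasurable"
    using K D by auto
  have Z: "negligible Z"
    unfolding Z_def using K n by (intro negligible_Union) (force intro!: negligible_hyperplane)+
  have ZD: "measure lebesgue Z = 0" "Z \<in> lmeasurable"
    using Z by (auto simp: negligible_imp_measure0 negligible_imp_measurable)
  have "ball 0 1 \<subseteq> (\<Union>x\<in>K. A x) \<union> (\<Union>x\<in>K. D x) \<union> Z"
  proof
    fix \<xi> :: 'a assume \<xi>: "\<xi> \<in> ball 0 1"
    obtain x where "x \<in> K" "\<xi> \<in> subdiff K v x"
      using subdiff_covers[OF K] by blast
    with \<xi> show "\<xi> \<in> (\<Union>x\<in>K. A x) \<union> (\<Union>x\<in>K. D x) \<union> Z"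
      by (cases "\<xi> \<bullet> n x" "0::real" rule: linorder_cases)
         (auto simp: A_def D_def Z_def inner_commute)
  qed
  then have "measure lebesgue (ball 0 1 :: 'a set)
      \<le> measure lebesgue ((\<Union>x\<in>K. A x) \<union> (\<Union>x\<in>K. D x) \<union> Z)"
    using UA UD ZD by (intro measure_mono_fmeasurable) auto
  also have "\<dots> \<le> measure lebesgue (\<Union>x\<in>K. A x) + measure lebesgue (\<Union>x\<in>K. D x)"
    using UA UD ZD measure_Un_le[of "(\<Union>x\<in>K. A x) \<union> (\<Union>x\<in>K. D x)" lebesgue Z]
      measure_Un_le[of "\<Union>x\<in>K. A x" lebesgue "\<Union>x\<in>K. D x"]
    by (simp add: fmeasurableD)
  also have "measure lebesgue (\<Union>x\<in>K. D x) \<le> (\<Sum>x\<in>K. measure lebesgue (D x))"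
    using K D by (intro measure_UNION_le) (auto simp: fmeasurableD)
  also have "\<dots> \<le> (\<Sum>x\<in>K. measure lebesgue (A x))"
    unfolding A_def D_def using n supp by (intro sum_mono measure_subdiff_inward_le_outward) auto
  also have "\<dots> = measure lebesgue (\<Union>x\<in>K. A x)"
  proof (rule measure_negligible_finite_Union_image[symmetric])
    show "pairwise (\<lambda>x y. negligible (A x \<inter> A y)) K"
      unfolding A_def pairwise_def
      by (intro ballI impI negligible_subset[OF negligible_subdiff_Int]) auto
  qed (use K A in auto)
  finally show "measure lebesgue (ball 0 1 :: 'a set) \<le> 2 * measure lebesgue (\<Union>x\<in>K. A x)"
    by simp
qed

section \<open>Normals of a convex set and the half ball\<close>

text \<open>
  If the normal at \<open>x\<close> had a positive inner product with \<open>y - x\<close>, the segment from \<open>x\<close> to \<open>y\<close>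
  would leave \<open>C\<close> at once, contrary to convexity.
\<close>

lemma outer_unit_normal_supports:
  assumes "closed C" "convex C" "class_C1 C" and x: "x \<in> frontier C"
  shows "norm (outer_unit_normal C x) = 1"
    and "y \<in> C \<Longrightarrow> outer_unit_normal C x \<bullet> (y - x) \<le> 0"
proof -
  obtain e \<psi> g where G: "C1_graph_at C x e \<psi> g"
    using assms unfolding class_C1_def by blast
  let ?n = "e - g (hyp_proj e x)"
  have eq: "outer_unit_normal C x = sgn ?n"
    by (rule outer_unit_normal_eq[OF G x])
  then show "norm (outer_unit_normal C x) = 1"
    using C1_graph_at_normal_nonzero[OF G] by (simp add: norm_sgn)
  assume y: "y \<in> C"
  have "?n \<bullet> (y - x) \<le> 0"
  proof (rule ccontr)
    assume "\<not> ?thesis"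
    then have "eventually (\<lambda>t. x + t *\<^sub>R (y - x) \<notin> C) (at_right (0::real))"
      by (intro C1_graph_at_ray(2)[OF G x]) simp
    moreover have "eventually (\<lambda>t. t \<in> {0<..<1}) (at_right (0::real))"
      by (rule eventually_at_right_real) simp
    ultimately have "eventually (\<lambda>t. False) (at_right (0::real))"
    proof eventually_elim
      case (elim t)
      have "x \<in> C"
        using x \<open>closed C\<close> frontier_subset_eq by blast
      then have "(1 - t) *\<^sub>R x + t *\<^sub>R y \<in> C"
        using y \<open>convex C\<close> elim by (intro convexD) auto
      moreover have "(1 - t) *\<^sub>R x + t *\<^sub>R y = x + t *\<^sub>R (y - x)"
        by (simp add: algebra_simps)
      ultimately show False
        using elim by simp
    qed
    then show False
      by simp
  qed
  then show "outer_unit_normal C x \<bullet> (y - x) \<le> 0"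
    unfolding eq by (simp add: sgn_div_norm divide_simps mult_le_0_iff)
qed

text \<open>The half ball and its image under \<open>uminus\<close> are disjoint subsets of the ball.\<close>

lemma measure_half_ball_le:
  fixes e :: "'a::euclidean_space"
  shows "half_ball e \<in> lmeasurable"
    and "2 * measure lebesgue (half_ball e) \<le> measure lebesgue (ball 0 1 :: 'a set)"
proof -
  have eq: "half_ball e = ball 0 1 \<inter> {x. e \<bullet> x > 0}"
    by (auto simp: half_ball_def inner_commute)
  have H: "half_ball e \<in> sets borel"
    unfolding eq using open_halfspace_gt[of 0 e] by (intro borel_open open_Int) auto
  then show L: "half_ball e \<in> lmeasurable"
    by (intro bounded_set_imp_lmeasurable) (auto simp: eq intro: bounded_Int)
  have orth: "orthogonal_transformation (uminus :: 'a \<Rightarrow> 'a)"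
    by (simp add: orthogonal_transformation_neg)
  let ?H' = "uminus -` half_ball e"
  have eq': "?H' = ball 0 1 \<inter> {x. e \<bullet> x < 0}"
    by (auto simp: half_ball_def inner_commute)
  have L': "?H' \<in> lmeasurable"
    unfolding eq' using open_halfspace_lt[of e 0]
    by (intro lmeasurable_open bounded_Int) auto
  have "2 * measure lebesgue (half_ball e) = measure lebesgue (half_ball e) + measure lebesgue ?H'"
    using measure_orthogonal_vimage[OF orth H] by simp
  also have "\<dots> = measure lebesgue (half_ball e \<union> ?H')"
    using fmeasurableD2[OF L] fmeasurableD2[OF L'] fmeasurableD[OF L] fmeasurableD[OF L']
    by (intro measure_Union[symmetric]) (auto simp: half_ball_def)
  also have "\<dots> \<le> measure lebesgue (ball 0 1 :: 'a set)"
    using L L' by (intro measure_mono_fmeasurable) (auto simp: eq eq' fmeasurableD)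
  finally show "2 * measure lebesgue (half_ball e) \<le> measure lebesgue (ball 0 1 :: 'a set)" .
qed

theorem proposition2p11:
  fixes C :: "(real ^ 'n) set" and k :: 'n
  assumes "closed C" and "convex C" and "interior C \<noteq> {}" and "class_C1 C"
  shows "zero_ABP (axis k 1) C"
  unfolding zero_ABP_def
proof (intro allI impI, elim conjE)
  fix K and v :: "real ^ 'n \<Rightarrow> real"
  assume K: "finite K" "K \<noteq> {}" "K \<subseteq> frontier C"
  let ?n = "outer_unit_normal C" and ?e = "axis k 1 :: real ^ 'n"
  let ?U = "\<Union>x\<in>K. subdiff K v x \<inter> ball 0 1 \<inter> {\<xi>. \<xi> \<bullet> ?n x > 0}"
  have U: "outward_subgradients C K v \<inter> ball 0 1 = ?U"
    by (auto simp: outward_subgradients_def)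
  have n: "norm (?n x) = 1" if "x \<in> K" for x
    using outer_unit_normal_supports(1)[OF assms(1,2,4)] K that by blast
  have supp: "?n x \<bullet> (y - x) \<le> 0" if "x \<in> K" "y \<in> K" for x y
    using outer_unit_normal_supports(2)[OF assms(1,2,4)] K that frontier_subset_closed[OF assms(1)] by blast
  have "2 * measure lebesgue (half_ball ?e) \<le> 2 * measure lebesgue ?U"
    using measure_half_ball_le(2)[of ?e] measure_outward_subgradients_ge(2)[OF K(1,2) n supp, of v]
    by linarith
  moreover have "?U \<in> lmeasurable"
    by (rule measure_outward_subgradients_ge(1)[OF K(1,2) n supp])
  ultimately show "emeasure lebesgue (outward_subgradients C K v \<inter> ball 0 1)
      \<ge> emeasure lebesgue (half_ball ?e)"
    unfolding U using measure_half_ball_le(1)[of ?e] by (simp add: emeasure_eq_measure2)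
qed

end
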